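(* There exist positive constants $C_1,C_2,K_1,K_2$ such that the following holds. If the parameters $a,b\in\mathbb R$ and $\mu>0$ satisfy $$|a|+1\le C_1\sqrt{b\mu},\qquad b\ge C_2\mu,$$ then the rotation number $\rho_{a,b,\mu}$ of the Poincaré map of the equation $\dfrac{dx}{dt}=\dfrac{\cos x+a+b\cos t}{\mu}$ satisfies $$\left|\frac a\mu-\rho_{a,b,\mu}\right|\le \frac{K_1}{\sqrt{b\mu}}+\frac{K_2}{b\mu}\ln\left(\frac b\mu\right)\le \frac{K_1}{\sqrt{b\mu}}+\frac{2K_2}{\sqrt{b\mu^3}}.$$
   Context: For $a,b\in\mathbb R$, $\mu>0$ consider the Josephson equation $\frac{dx}{dt}=\frac{\cos x+a+b\cos t}{\mu}$, with $x$ regarded as real-valued. Its right-hand side is $2\pi$-periodic in both $x$ and $t$. Let $\widetilde P_{a,b,\mu}:\mathbb R\to\mathbb R$ be the time-$2\pi$ map: $\widetilde P_{a,b,\mu}(x_0)=x(2\pi)$, where $x(t)$ is the solution with $x(0)=x_0$. It is a lift of the Poincaré map $P_{a,b,\mu}$ of the circle $\mathbb R/2\pi\mathbb Z$. The rotation number is $$\rho_{a,b,\mu}=\lim_{n\to\infty}\frac{\widetilde P_{a,b,\mu}^{\circ n}(x)-x}{2\pi n},$$ where the limit exists and does not depend on $x\in\mathbb R$. The constants $C_1,C_2,K_1,K_2$ are absolute (independent of $a,b,\mu$). *)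

theory Defs
  imports Complex_Main
begin

definition josephson_solution ::
  "real \<Rightarrow> real \<Rightarrow> real \<Rightarrow> real set \<Rightarrow> (real \<Rightarrow> real) \<Rightarrow> bool" where
  "josephson_solution a b \<mu> T x \<longleftrightarrow>
     (\<forall>t\<in>T. (x has_real_derivative (cos (x t) + a + b * cos t) / \<mu>) (at t within T))"

text \<open>For \<open>\<mu> > 0\<close> the right-hand side is smooth and globally Lipschitz in the unknown, so
  every initial value has a solution on \<open>[0, 2\<pi>]\<close>, unique there; hence the description below
  is proper.\<close>

definition poincare_lift :: "real \<Rightarrow> real \<Rightarrow> real \<Rightarrow> real \<Rightarrow> real" where
  "poincare_lift a b \<mu> x\<^sub>0 =
     (THE y. \<exists>x. josephson_solution a b \<mu> {0..2 * pi} x \<and> x 0 = x\<^sub>0 \<and> x (2 * pi) = y)"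

text \<open>The number is required to be the limit for every starting point \<open>x\<close>, as the limit exists
  and is independent of \<open>x\<close>. The term for \<open>n = 0\<close>, a division by zero, is irrelevant.\<close>

definition rotation_number :: "real \<Rightarrow> real \<Rightarrow> real \<Rightarrow> real" where
  "rotation_number a b \<mu> =
     (THE \<rho>. \<forall>x. (\<lambda>n. ((poincare_lift a b \<mu> ^^ n) x - x) / (2 * pi * real n)) \<longlonglongrightarrow> \<rho>)"

end

theory Submission
  imports Defs "HOL-Analysis.Analysis"
begin

text \<open>Over one period the displacement is \<open>2\<pi>a/\<mu>\<close> plus \<open>(1/\<mu>) \<integral> cos x dt\<close>, so it suffices to bound
  this oscillatory integral for every solution. With \<open>\<delta> = sqrt (\<mu>/b)\<close>, outside the
  \<open>\<delta>\<close>-neighbourhoods of the zeros of \<open>cos t\<close> the hypothesis \<open>\<bar>a\<bar> + 1 \<le> sqrt (b\<mu>) / 4\<close> gives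
  \<open>\<bar>x'\<bar> \<ge> b \<bar>cos t\<bar> / (2\<mu>)\<close>, and integration by parts yields the boundary terms \<open>sin x / x'\<close> of size
  \<open>O(\<delta>)\<close> and the integral of \<open>sin x x'' / x'\<^sup>2\<close>, which is bounded by the integral of
  \<open>2 / (b \<bar>cos t\<bar>) + 4\<mu> / (b cos\<^sup>2 t)\<close>, that is by \<open>O(ln (b/\<mu>) / b + \<delta>)\<close>. The neighbourhoods
  themselves contribute at most \<open>4\<delta>\<close>.\<close>

subsection \<open>Global existence for Lipschitz equations\<close>

text \<open>Both \<open>h + g\<close> and \<open>h - g\<close> have nonnegative derivative. This
  replaces estimates of integrals throughout: \<open>h\<close> is chosen as an explicit
  antiderivative of the bound on \<open>g'\<close>.\<close>

lemma abs_diff_le_of_derivative_bound: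
  fixes g h :: "real \<Rightarrow> real"
  assumes "\<alpha> \<le> \<beta>"
    and g: "\<And>t. t \<in> {\<alpha>..\<beta>} \<Longrightarrow> (g has_real_derivative g' t) (at t within {\<alpha>..\<beta>})"
    and h: "\<And>t. t \<in> {\<alpha>..\<beta>} \<Longrightarrow> (h has_real_derivative h' t) (at t within {\<alpha>..\<beta>})"
    and le: "\<And>t. t \<in> {\<alpha>..\<beta>} \<Longrightarrow> \<bar>g' t\<bar> \<le> h' t"
  shows "\<bar>g \<beta> - g \<alpha>\<bar> \<le> h \<beta> - h \<alpha>"
proof -
  have mono: "h \<alpha> + c * g \<alpha> \<le> h \<beta> + c * g \<beta>" if c: "\<bar>c\<bar> = 1" for c :: real
  proof (rule DERIV_nonneg_imp_increasing_open[OF \<open>\<alpha> \<le> \<beta>\<close>])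
    fix t assume t: "\<alpha> < t" "t < \<beta>"
    then have "at t within {\<alpha>..\<beta>} = at t" by (simp add: at_within_Icc_at)
    then have "((\<lambda>t. h t + c * g t) has_real_derivative h' t + c * g' t) (at t)"
      using g[of t] h[of t] t by (auto intro!: derivative_eq_intros)
    moreover have "h' t + c * g' t \<ge> 0"
      using le[of t] t c by (auto simp: abs_if split: if_splits)
    ultimately show "\<exists>y. ((\<lambda>t. h t + c * g t) has_real_derivative y) (at t) \<and> y \<ge> 0"
      by blast
  next
    show "continuous_on {\<alpha>..\<beta>} (\<lambda>t. h t + c * g t)"
      by (intro continuous_intros DERIV_continuous_on[OF g] DERIV_continuous_on[OF h])
  qed
  from mono[of 1] mono[of "-1"] show ?thesis by simp
qed

text \<open>The Lipschitz constant is uniform in the unknown, so the Picard iterates converge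
  uniformly on the whole interval and no continuation of local solutions has to be made.\<close>

theorem picard_lindelof_global:
  fixes f :: "real \<Rightarrow> real \<Rightarrow> real"
  assumes "0 \<le> T" "0 < L"
    and cont: "continuous_on ({0..T} \<times> UNIV) (\<lambda>(t, x). f t x)"
    and lip: "\<And>t x y. t \<in> {0..T} \<Longrightarrow> \<bar>f t x - f t y\<bar> \<le> L * \<bar>x - y\<bar>"
  obtains x where "x 0 = x\<^sub>0"
    and "\<And>t. t \<in> {0..T} \<Longrightarrow> (x has_real_derivative f t (x t)) (at t within {0..T})"
proof -
  define X where "X = rec_nat (\<lambda>t. x\<^sub>0) (\<lambda>n y t. x\<^sub>0 + integral {0..t} (\<lambda>s. f s (y s)))"
  have X0: "X 0 = (\<lambda>t. x\<^sub>0)" and XSuc: "X (Suc n) = (\<lambda>t. x\<^sub>0 + integral {0..t} (\<lambda>s. f s (X n s)))" for n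
    by (simp_all add: X_def)
  have fcont: "continuous_on {0..T} (\<lambda>s. f s (y s))" if "continuous_on {0..T} y" for y
    using continuous_on_compose2[OF cont, of "{0..T}" "\<lambda>s. (s, y s)"] that
    by (simp add: continuous_on_Pair image_subset_iff)
  have der: "((\<lambda>t. x\<^sub>0 + integral {0..t} (\<lambda>s. f s (y s))) has_real_derivative f t (y t)) (at t within {0..T})"
    if "continuous_on {0..T} y" "t \<in> {0..T}" for y t
    using integral_has_real_derivative[OF fcont[OF that(1)] that(2)]
    by (auto intro!: derivative_eq_intros)
  have Xcont: "continuous_on {0..T} (X n)" for n
  proof (induction n)
    case 0
    then show ?case by (simp add: X0)
  next
    case (Suc n)
    then show ?case unfolding XSuc by (rule DERIV_continuous_on[OF der])
  qed
  \<comment> \<open>\<open>D\<close> bounds the first Picard increment and starts the geometric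
    decay.\<close>
  have "compact ((\<lambda>t. X 1 t - X 0 t) ` {0..T})"
    using Xcont by (intro compact_continuous_image continuous_intros) auto
  then obtain D where D: "\<And>t. t \<in> {0..T} \<Longrightarrow> \<bar>X 1 t - X 0 t\<bar> \<le> D"
    by (meson compact_imp_bounded bounded_real imageI)
  have D0: "D \<ge> 0" using D[of 0] \<open>0 \<le> T\<close> by auto
  \<comment> \<open>In the norm weighted by \<open>exp (- 2 L t)\<close> the Picard operator contracts by \<open>1/2\<close> on all of \<open>[0, T]\<close>.\<close>
  have step: "\<bar>X (Suc n) t - X n t\<bar> \<le> D * (1/2) ^ n * exp (2 * L * t)" if "t \<in> {0..T}" for n t
    using that
  proof (induction n arbitrary: t)
    case 0
    have "1 \<le> exp (2 * L * t)" using 0 \<open>0 < L\<close> by simp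
    then have "D * 1 \<le> D * exp (2 * L * t)" using D0 by (intro mult_left_mono)
    then show ?case using D[OF 0] by simp
  next
    case (Suc n)
    let ?E = "D * (1/2) ^ Suc n"
    \<comment> \<open>All iterates agree at 0. Differentiating \<open>exp (2 * L * t)\<close> yields
      the factor \<open>2 * L\<close>, which absorbs both the Lipschitz constant and the new factor
      1/2.\<close>
    have "\<bar>(X (Suc (Suc n)) t - X (Suc n) t) - (X (Suc (Suc n)) 0 - X (Suc n) 0)\<bar>
        \<le> ?E * exp (2 * L * t) - ?E * exp (2 * L * 0)"
    proof (rule abs_diff_le_of_derivative_bound[where g = "\<lambda>t. X (Suc (Suc n)) t - X (Suc n) t"
          and g' = "\<lambda>t. f t (X (Suc n) t) - f t (X n t)" and h = "\<lambda>t. ?E * exp (2 * L * t)"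
          and h' = "\<lambda>t. L * (D * (1/2) ^ n * exp (2 * L * t))"])
      show "0 \<le> t" using Suc by simp
    next
      fix s assume s: "s \<in> {0..t}"
      then have s': "s \<in> {0..T}" using Suc by auto
      have sub: "{0..t} \<subseteq> {0..T}" using Suc by auto
      show "((\<lambda>t. X (Suc (Suc n)) t - X (Suc n) t) has_real_derivative
          f s (X (Suc n) s) - f s (X n s)) (at s within {0..t})"
        unfolding XSuc[of "Suc n"] XSuc[of n]
        using der[OF Xcont s', of "Suc n"] der[OF Xcont s', of n]
        by (intro DERIV_diff) (auto intro: DERIV_subset[OF _ sub] simp: XSuc)
      show "((\<lambda>t. ?E * exp (2 * L * t)) has_real_derivative
          L * (D * (1/2) ^ n * exp (2 * L * s))) (at s within {0..t})"
        by (auto intro!: derivative_eq_intros)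
      have "\<bar>f s (X (Suc n) s) - f s (X n s)\<bar> \<le> L * \<bar>X (Suc n) s - X n s\<bar>"
        by (rule lip[OF s'])
      also have "\<dots> \<le> L * (D * (1/2) ^ n * exp (2 * L * s))"
        using Suc.IH[OF s'] \<open>0 < L\<close> by (intro mult_left_mono) auto
      finally show "\<bar>f s (X (Suc n) s) - f s (X n s)\<bar> \<le> L * (D * (1/2) ^ n * exp (2 * L * s))" .
    qed
    moreover have "X (Suc (Suc n)) 0 = x\<^sub>0" "X (Suc n) 0 = x\<^sub>0" by (simp_all add: XSuc)
    moreover have "?E \<ge> 0" using D0 by simp
    ultimately show ?case by simp
  qed
  \<comment> \<open>The iterates are partial sums of a telescoping series dominated by a geometric
    one.\<close>
  have "uniform_limit {0..T} (\<lambda>n t. \<Sum>i<n. X (Suc i) t - X i t)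
      (\<lambda>t. \<Sum>i. X (Suc i) t - X i t) sequentially"
  proof (rule Weierstrass_m_test)
    fix n t assume t: "t \<in> {0..T}"
    have "D * (1/2) ^ n * exp (2 * L * t) \<le> D * (1/2) ^ n * exp (2 * L * T)"
      using t D0 \<open>0 < L\<close> by (intro mult_left_mono) auto
    then show "norm (X (Suc n) t - X n t) \<le> D * (1/2) ^ n * exp (2 * L * T)"
      using step[OF t, of n] by simp
  next
    show "summable (\<lambda>n. D * (1/2) ^ n * exp (2 * L * T))"
      by (intro summable_mult summable_mult2 summable_geometric) simp
  qed
  then have "uniform_limit {0..T} (\<lambda>n t. X n t - x\<^sub>0)
      (\<lambda>t. \<Sum>i. X (Suc i) t - X i t) sequentially"
    by (simp only: sum_lessThan_telescope[where f = "\<lambda>i. X i _"] X0)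
  moreover define Y where "Y t = x\<^sub>0 + (\<Sum>i. X (Suc i) t - X i t)" for t
  ultimately have lim: "uniform_limit {0..T} X Y sequentially"
    by (simp add: uniform_limit_iff dist_real_def algebra_simps)
  have Ycont: "continuous_on {0..T} Y"
    by (rule uniform_limit_theorem[OF _ lim]) (auto simp: Xcont)
  \<comment> \<open>The Lipschitz bound transfers uniform convergence to the integrands, so the
    limit passes under the integral.\<close>
  have flim: "uniform_limit {0..T} (\<lambda>n s. f s (X n s)) (\<lambda>s. f s (Y s)) sequentially"
  proof (rule uniform_limitI)
    fix e :: real assume "e > 0"
    then have "e / L > 0" using \<open>0 < L\<close> by simp
    from uniform_limitD[OF lim this]
    show "\<forall>\<^sub>F n in sequentially. \<forall>s\<in>{0..T}. dist (f s (X n s)) (f s (Y s)) < e"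
    proof (eventually_elim, safe)
      fix n s assume *: "\<forall>x\<in>{0..T}. dist (X n x) (Y x) < e / L" and s: "s \<in> {0..T}"
      have "\<bar>X n s - Y s\<bar> < e / L" using * s by (auto simp: dist_real_def)
      then have "L * \<bar>X n s - Y s\<bar> < e" using \<open>0 < L\<close> by (simp add: field_simps)
      then show "dist (f s (X n s)) (f s (Y s)) < e"
        using lip[OF s, of "X n s" "Y s"] by (simp add: dist_real_def)
    qed
  qed
  have Yint: "Y t = x\<^sub>0 + integral {0..t} (\<lambda>s. f s (Y s))" if t: "t \<in> {0..T}" for t
  proof -
    have sub: "{0..t} \<subseteq> {0..T}" using t by auto
    obtain I J where I: "\<And>n. ((\<lambda>s. f s (X n s)) has_integral I n) {0..t}"
      and J: "((\<lambda>s. f s (Y s)) has_integral J) {0..t}" and IJ: "I \<longlonglongrightarrow> J"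
      by (rule uniform_limit_integral[OF uniform_limit_on_subset[OF flim sub]
            continuous_on_subset[OF fcont[OF Xcont] sub] sequentially_bot]) (rule that)
    have "X (Suc n) t = x\<^sub>0 + I n" for n
      using I[of n] by (simp add: XSuc integral_unique)
    then have "(\<lambda>n. X (Suc n) t) \<longlonglongrightarrow> x\<^sub>0 + J"
      using IJ by (auto intro!: tendsto_intros)
    moreover have "(\<lambda>n. X (Suc n) t) \<longlonglongrightarrow> Y t"
      using tendsto_uniform_limitI[OF lim t] by (rule LIMSEQ_Suc)
    ultimately have "Y t = x\<^sub>0 + J" by (rule LIMSEQ_unique[symmetric])
    then show ?thesis using J by (simp add: integral_unique)
  qed
  show thesis
  proof (rule that)
    show "Y 0 = x\<^sub>0" using Yint[of 0] \<open>0 \<le> T\<close> by simp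
    fix t assume t: "t \<in> {0..T}"
    show "(Y has_real_derivative f t (Y t)) (at t within {0..T})"
      \<comment> \<open>\<open>Y\<close> is known to equal its integral formula only on
        \<open>{0..T}\<close>, which suffices for the derivative within that set; the radius 1 is
        arbitrary.\<close>
      by (rule has_field_derivative_transform_within[OF der[OF Ycont t], of 1])
        (use t Yint in auto)
  qed
qed

subsection \<open>Translation numbers\<close>

lemma funpow_degree_one:
  fixes f :: "real \<Rightarrow> real"
  assumes "mono f" and "\<And>x. f (x + p) = f x + p"
  shows "mono (f ^^ n)" and "(f ^^ n) (x + p) = (f ^^ n) x + p"
proof -
  show "mono (f ^^ n)" using assms(1) by (rule mono_pow)
  show "(f ^^ n) (x + p) = (f ^^ n) x + p"
    by (induction n) (simp_all add: assms(2))
qed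

text \<open>Enclose \<open>x\<close> between consecutive multiples of \<open>p\<close>, where
  \<open>g\<close> is explicit, and use monotonicity. The bound does not depend on \<open>g\<close>,
  so it serves all iterates of a map at once.\<close>

lemma degree_one_displacement:
  fixes g :: "real \<Rightarrow> real"
  assumes "mono g" and shift: "\<And>x. g (x + p) = g x + p" and "p > 0"
  shows "\<bar>g x - x - g 0\<bar> \<le> p"
proof -
  have nat: "g (y + real k * p) = g y + real k * p" for y k
  proof (induction k)
    case (Suc k)
    then show ?case using shift[of "y + real k * p"] by (simp add: algebra_simps)
  qed simp
  have int: "g (real_of_int k * p) = g 0 + real_of_int k * p" for k
  proof (cases "k \<ge> 0")
    case True
    then show ?thesis using nat[of 0 "nat k"] by simp
  next
    case False
    \<comment> \<open>For negative \<open>k\<close>, the shift by \<open>- k\<close> periods leads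
      from \<open>k * p\<close> back to 0.\<close>
    then show ?thesis using nat[of "real_of_int k * p" "nat (- k)"] by simp
  qed
  define k where "k = \<lfloor>x / p\<rfloor>"
  have "real_of_int k \<le> x / p" "x / p \<le> real_of_int (k + 1)" unfolding k_def by linarith+
  then have lo: "real_of_int k * p \<le> x" and hi: "x \<le> real_of_int (k + 1) * p"
    using \<open>p > 0\<close> by (simp_all add: field_simps)
  have "g 0 + real_of_int k * p \<le> g x" "g x \<le> g 0 + real_of_int (k + 1) * p"
    using monoD[OF \<open>mono g\<close> lo] monoD[OF \<open>mono g\<close> hi] int[of k] int[of "k + 1"] by simp_all
  then show ?thesis using lo hi by (simp add: algebra_simps abs_le_iff)
qed

text \<open>The displacement of the n-th iterate varies by at most \<open>p\<close> with the
  starting point. Hence the averages along the orbit of 0 form a Cauchy sequence, and every other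
  orbit has the same limit.\<close>

theorem translation_number_exists:
  fixes f :: "real \<Rightarrow> real"
  assumes "mono f" and "\<And>x. f (x + p) = f x + p" and "p > 0"
  obtains \<rho> where "\<And>x. (\<lambda>n. ((f ^^ n) x - x) / (p * real n)) \<longlonglongrightarrow> \<rho>"
proof -
  define A where "A n = (f ^^ n) 0" for n
  have disp: "\<bar>(f ^^ n) x - x - A n\<bar> \<le> p" for n x
    unfolding A_def using funpow_degree_one[OF assms(1,2)] \<open>p > 0\<close>
    by (intro degree_one_displacement) auto
  \<comment> \<open>The orbit of length \<open>n * m\<close> is cut into \<open>m\<close> blocks of
    length \<open>n\<close>; each block moves by \<open>A n\<close> up to an error
    \<open>p\<close>.\<close>
  have mult: "\<bar>A (n * m) - real m * A n\<bar> \<le> real m * p" for n m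
  proof (induction m)
    case 0
    then show ?case by (simp add: A_def)
  next
    case (Suc m)
    have "A (n * Suc m) = (f ^^ n) (A (n * m))" by (simp add: A_def funpow_add)
    then show ?case using Suc disp[of n "A (n * m)"] by (simp add: algebra_simps abs_le_iff)
  qed
  define r where "r n = A n / (p * real n)" for n
  have mult': "\<bar>r (n * m) - r n\<bar> \<le> 1 / real n" if "n > 0" "m > 0" for n m
  proof -
    have "r (n * m) - r n = (A (n * m) - real m * A n) / (p * real n * real m)"
      using that \<open>p > 0\<close> by (simp add: r_def field_simps)
    also have "\<bar>\<dots>\<bar> = \<bar>A (n * m) - real m * A n\<bar> / (p * real n * real m)"
      using that \<open>p > 0\<close> by (simp add: abs_mult)
    also have "\<dots> \<le> real m * p / (p * real n * real m)"
      using mult that \<open>p > 0\<close> by (intro divide_right_mono) auto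
    also have "\<dots> = 1 / real n" using that \<open>p > 0\<close> by simp
    finally show ?thesis .
  qed
  have "Cauchy r"
  proof (rule metric_CauchyI)
    fix e :: real assume "e > 0"
    then obtain N where N: "N > 0" "1 / real N < e / 2"
      using real_arch_inverse[of "e / 2"] by (auto simp: inverse_eq_divide)
    show "\<exists>M. \<forall>m\<ge>M. \<forall>n\<ge>M. dist (r m) (r n) < e"
    proof (intro exI allI impI)
      fix m n assume mn: "m \<ge> N" "n \<ge> N"
      \<comment> \<open>Both averages are compared with the one of index
        \<open>n * m\<close>.\<close>
      have "\<bar>r (n * m) - r n\<bar> \<le> 1 / real n" "\<bar>r (n * m) - r m\<bar> \<le> 1 / real m"
        using mult'[of n m] mult'[of m n] mn N by (simp_all add: mult.commute)
      moreover have "1 / real n \<le> 1 / real N" "1 / real m \<le> 1 / real N"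
        using mn N by (simp_all add: frac_le)
      ultimately show "dist (r m) (r n) < e" using N(2) unfolding dist_real_def by linarith
    qed
  qed
  then obtain \<rho> where \<rho>: "r \<longlonglongrightarrow> \<rho>" using Cauchy_convergent_iff convergent_def by blast
  show thesis
  proof (rule that)
    fix x
    have "(\<lambda>n. ((f ^^ n) x - x - A n) / (p * real n)) \<longlonglongrightarrow> 0"
    proof (rule Lim_null_comparison)
      show "\<forall>\<^sub>F n in sequentially. norm (((f ^^ n) x - x - A n) / (p * real n)) \<le> 1 / real n"
      proof (rule eventually_sequentiallyI[of 1])
        fix n :: nat assume "1 \<le> n"
        have "norm (((f ^^ n) x - x - A n) / (p * real n)) = \<bar>(f ^^ n) x - x - A n\<bar> / (p * real n)"
          using \<open>p > 0\<close> by (simp add: abs_mult)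
        also have "\<dots> \<le> p / (p * real n)"
          using disp \<open>p > 0\<close> by (intro divide_right_mono) auto
        finally show "norm (((f ^^ n) x - x - A n) / (p * real n)) \<le> 1 / real n"
          using \<open>p > 0\<close> by simp
      qed
    qed (rule lim_1_over_n)
    from tendsto_add[OF this \<rho>]
    show "(\<lambda>n. ((f ^^ n) x - x) / (p * real n)) \<longlonglongrightarrow> \<rho>"
      by (simp add: r_def diff_divide_distrib)
  qed
qed

lemma funpow_displacement_bound:
  fixes f :: "real \<Rightarrow> real"
  assumes "\<And>x. \<bar>f x - x - c\<bar> \<le> e"
  shows "\<bar>(f ^^ n) x - x - real n * c\<bar> \<le> real n * e"
proof (induction n)
  case (Suc n)
  then show ?case using assms[of "(f ^^ n) x"] by (simp add: algebra_simps abs_le_iff)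
qed simp

text \<open>One-step errors add up to at most \<open>n * p * e\<close> after \<open>n\<close> steps,
  so every average, and therefore the limit, inherits the error \<open>e\<close>.\<close>

lemma translation_number_bound:
  fixes f :: "real \<Rightarrow> real"
  assumes bound: "\<And>x. \<bar>f x - x - p * c\<bar> \<le> p * e" and "p > 0"
    and lim: "(\<lambda>n. ((f ^^ n) x - x) / (p * real n)) \<longlonglongrightarrow> \<rho>"
  shows "\<bar>c - \<rho>\<bar> \<le> e"
proof -
  have "(\<lambda>n. \<bar>c - ((f ^^ n) x - x) / (p * real n)\<bar>) \<longlonglongrightarrow> \<bar>c - \<rho>\<bar>"
    by (intro tendsto_intros lim)
  moreover have "\<bar>c - ((f ^^ n) x - x) / (p * real n)\<bar> \<le> e" if "n \<ge> 1" for n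
  proof -
    have "c - ((f ^^ n) x - x) / (p * real n) = - ((f ^^ n) x - x - real n * (p * c)) / (p * real n)"
      using that \<open>p > 0\<close> by (simp add: field_simps)
    also have "\<bar>\<dots>\<bar> = \<bar>(f ^^ n) x - x - real n * (p * c)\<bar> / (p * real n)"
      using that \<open>p > 0\<close> by (simp add: abs_mult)
    also have "\<dots> \<le> real n * (p * e) / (p * real n)"
      using funpow_displacement_bound[OF bound, of n x] \<open>p > 0\<close> by (intro divide_right_mono) auto
    finally show ?thesis using that \<open>p > 0\<close> by simp
  qed
  ultimately show ?thesis by (intro Lim_bounded[of _ _ 1]) auto
qed

subsection \<open>The period map\<close>

lemma abs_cos_diff_le: "\<bar>cos x - cos y\<bar> \<le> \<bar>x - y\<bar>" for x y :: real
proof -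
  have "\<bar>cos v - cos u\<bar> \<le> v - u" if "u \<le> v" for u v :: real
    using that by (intro abs_diff_le_of_derivative_bound[where g' = "\<lambda>t. - sin t" and h' = "\<lambda>t. 1"])
      (auto intro!: derivative_eq_intros)
  from this[of x y] this[of y x] show ?thesis by (cases x y rule: le_cases) auto
qed

lemma josephson_solution_exists:
  assumes "\<mu> > 0"
  obtains x where "josephson_solution a b \<mu> {0..2 * pi} x" "x 0 = x\<^sub>0"
proof -
  obtain x where "x 0 = x\<^sub>0" and "\<And>t. t \<in> {0..2 * pi} \<Longrightarrow>
      (x has_real_derivative (cos (x t) + a + b * cos t) / \<mu>) (at t within {0..2 * pi})"
  proof (rule picard_lindelof_global[where T = "2 * pi" and L = "1 / \<mu>" and x\<^sub>0 = x\<^sub>0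
        and f = "\<lambda>t x. (cos x + a + b * cos t) / \<mu>"])
    show "continuous_on ({0..2 * pi} \<times> UNIV) (\<lambda>(t, x). (cos x + a + b * cos t) / \<mu>)"
      using assms by (auto intro!: continuous_intros simp: case_prod_beta)
    fix t x y :: real
    have "\<bar>cos x - cos y\<bar> \<le> \<bar>x - y\<bar>"
      by (rule abs_cos_diff_le)
    then show "\<bar>(cos x + a + b * cos t) / \<mu> - (cos y + a + b * cos t) / \<mu>\<bar> \<le> 1 / \<mu> * \<bar>x - y\<bar>"
      using assms by (simp add: diff_divide_distrib[symmetric] divide_right_mono)
  qed (use assms in auto)
  then show thesis by (intro that[of x]) (auto simp: josephson_solution_def)
qed

text \<open>For the difference \<open>d\<close> of two solutions \<open>\<bar>d'\<bar> \<le> \<bar>d\<bar> / \<mu>\<close>, so \<open>d\<^sup>2 exp (2t/\<mu>)\<close> is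
  nondecreasing and \<open>d\<^sup>2 exp (-2t/\<mu>)\<close> is nonincreasing.\<close>

lemma josephson_difference_bounds:
  assumes "\<mu> > 0" and t: "0 \<le> t" "t \<le> T"
    and x: "josephson_solution a b \<mu> {0..T} x" and y: "josephson_solution a b \<mu> {0..T} y"
  shows "(x 0 - y 0)\<^sup>2 \<le> (x t - y t)\<^sup>2 * exp (2 / \<mu> * t)"
    and "(x t - y t)\<^sup>2 \<le> (x 0 - y 0)\<^sup>2 * exp (2 / \<mu> * t)"
proof -
  define d where "d t = x t - y t" for t
  have der: "(d has_real_derivative (cos (x s) - cos (y s)) / \<mu>) (at s within {0..t})"
    if "s \<in> {0..t}" for s
  proof -
    have "{0..t} \<subseteq> {0..T}" "s \<in> {0..T}" using t that by auto
    then show ?thesis using x y unfolding josephson_solution_def d_def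
      by (auto intro!: derivative_eq_intros DERIV_subset[of _ _ s "{0..T}" "{0..t}"]
          simp: diff_divide_distrib[symmetric])
  qed
  have d': "\<bar>2 * d s * ((cos (x s) - cos (y s)) / \<mu>)\<bar> \<le> 2 / \<mu> * (d s)\<^sup>2" for s
  proof -
    have "\<bar>d s\<bar> * \<bar>cos (x s) - cos (y s)\<bar> \<le> \<bar>d s\<bar> * \<bar>d s\<bar>"
      unfolding d_def by (intro mult_left_mono abs_cos_diff_le) simp
    then have "2 * (\<bar>d s\<bar> * \<bar>cos (x s) - cos (y s)\<bar>) / \<mu> \<le> 2 * (\<bar>d s\<bar> * \<bar>d s\<bar>) / \<mu>"
      using \<open>\<mu> > 0\<close> by (intro divide_right_mono) auto
    then show ?thesis using \<open>\<mu> > 0\<close> by (simp add: abs_mult power2_eq_square mult.assoc)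
  qed
  \<comment> \<open>Both monotonicity claims in one: for \<open>k = -1\<close> the leading factor
    turns the nonincreasing function into a nondecreasing one.\<close>
  have sgn: "k * (d 0)\<^sup>2 \<le> k * ((d t)\<^sup>2 * exp (k * (2 / \<mu>) * t))" if k: "k = 1 \<or> k = -1" for k :: real
  proof -
    define F where "F s = k * ((d s)\<^sup>2 * exp (k * (2 / \<mu>) * s))" for s
    define F' where "F' s = exp (k * (2 / \<mu>) * s) *
      (k * (2 * d s * ((cos (x s) - cos (y s)) / \<mu>) + k * (2 / \<mu> * (d s)\<^sup>2)))" for s
    have F: "(F has_real_derivative F' s) (at s within {0..t})" if "s \<in> {0..t}" for s
      unfolding F_def[abs_def] F'_def
      by (rule derivative_eq_intros der[OF that] refl)+ (simp add: algebra_simps power2_eq_square)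
    have "F 0 \<le> F t"
    proof (rule DERIV_nonneg_imp_increasing_open[OF t(1)])
      show "continuous_on {0..t} F" by (rule DERIV_continuous_on[OF F])
      fix s assume s: "0 < s" "s < t"
      \<comment> \<open>As \<open>k * k = 1\<close>, this is \<open>k * w + z\<close>.\<close>
      have "0 \<le> k * (w + k * z)" if "\<bar>w\<bar> \<le> z" for w z :: real
        using that k by auto
      from this[OF d'] have "F' s \<ge> 0" unfolding F'_def by (rule mult_nonneg_nonneg[OF exp_ge_zero])
      moreover have "at s within {0..t} = at s" using s by (simp add: at_within_Icc_at)
      ultimately show "\<exists>y. (F has_real_derivative y) (at s) \<and> 0 \<le> y"
        using F[of s] s by auto
    qed
    then show ?thesis by (simp add: F_def)
  qed
  show "(x 0 - y 0)\<^sup>2 \<le> (x t - y t)\<^sup>2 * exp (2 / \<mu> * t)"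
    using sgn[of 1] by (simp add: d_def)
  have "(d t)\<^sup>2 * exp (- (2 / \<mu> * t)) \<le> (d 0)\<^sup>2" using sgn[of "-1"] by simp
  then have "(d t)\<^sup>2 * exp (- (2 / \<mu> * t)) * exp (2 / \<mu> * t) \<le> (d 0)\<^sup>2 * exp (2 / \<mu> * t)"
    by (intro mult_right_mono) auto
  then show "(x t - y t)\<^sup>2 \<le> (x 0 - y 0)\<^sup>2 * exp (2 / \<mu> * t)"
    by (simp add: d_def mult.assoc flip: exp_add)
qed

text \<open>Equal initial values force equal end values by the second difference bound, so the
  definite description is determined by any one solution.\<close>

lemma poincare_lift_eq:
  assumes "\<mu> > 0" and x: "josephson_solution a b \<mu> {0..2 * pi} x"
  shows "poincare_lift a b \<mu> (x 0) = x (2 * pi)"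
  unfolding poincare_lift_def
proof (rule the_equality)
  show "\<exists>z. josephson_solution a b \<mu> {0..2 * pi} z \<and> z 0 = x 0 \<and> z (2 * pi) = x (2 * pi)"
    using x by blast
  fix w assume "\<exists>z. josephson_solution a b \<mu> {0..2 * pi} z \<and> z 0 = x 0 \<and> z (2 * pi) = w"
  then obtain z where z: "josephson_solution a b \<mu> {0..2 * pi} z" "z 0 = x 0" "z (2 * pi) = w"
    by blast
  show "w = x (2 * pi)"
    using josephson_difference_bounds(2)[OF \<open>\<mu> > 0\<close> _ _ z(1) x, of "2 * pi"] z by simp
qed

text \<open>If two solutions exchanged their order they would meet, by the intermediate value
  theorem; the first difference bound then makes their initial values equal.\<close>

lemma mono_poincare_lift:
  assumes "\<mu> > 0"
  shows "mono (poincare_lift a b \<mu>)"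
proof (rule monoI)
  fix u v :: real assume "u \<le> v"
  show "poincare_lift a b \<mu> u \<le> poincare_lift a b \<mu> v"
  proof (cases "u = v")
    case False
    then have "u < v" using \<open>u \<le> v\<close> by simp
    obtain x where x: "josephson_solution a b \<mu> {0..2 * pi} x" "x 0 = u"
      by (rule josephson_solution_exists[OF assms])
    obtain y where y: "josephson_solution a b \<mu> {0..2 * pi} y" "y 0 = v"
      by (rule josephson_solution_exists[OF assms])
    have "continuous_on {0..2 * pi} x" "continuous_on {0..2 * pi} y"
      using x y by (meson josephson_solution_def DERIV_continuous_on)+
    then have cont: "continuous_on {0..2 * pi} (\<lambda>t. x t - y t)" by (intro continuous_intros)
    have "x (2 * pi) \<le> y (2 * pi)"
    proof (rule ccontr)
      assume "\<not> ?thesis"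
      then obtain t where t: "0 \<le> t" "t \<le> 2 * pi" "x t - y t = 0"
        using IVT'[of "\<lambda>t. x t - y t" 0 0 "2 * pi", OF _ _ _ cont] \<open>u < v\<close> x y by auto
      then show False
        using josephson_difference_bounds(1)[OF assms t(1,2) x(1) y(1)] x y \<open>u < v\<close> by simp
    qed
    then show ?thesis using poincare_lift_eq[OF assms x(1)] poincare_lift_eq[OF assms y(1)] x y by simp
  qed simp
qed

lemma poincare_lift_shift:
  assumes "\<mu> > 0"
  shows "poincare_lift a b \<mu> (u + 2 * pi) = poincare_lift a b \<mu> u + 2 * pi"
proof -
  obtain x where x: "josephson_solution a b \<mu> {0..2 * pi} x" "x 0 = u"
    by (rule josephson_solution_exists[OF assms])
  then have "josephson_solution a b \<mu> {0..2 * pi} (\<lambda>t. x t + 2 * pi)"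
    by (auto simp: josephson_solution_def intro!: derivative_eq_intros)
  from poincare_lift_eq[OF assms this] poincare_lift_eq[OF assms x(1)] x(2)
  show ?thesis by simp
qed

text \<open>Reduces the theorem to a bound on the displacement over one period, uniform in the
  starting point.\<close>

lemma rotation_number_bound:
  assumes "\<mu> > 0"
    and "\<And>x. \<bar>poincare_lift a b \<mu> x - x - 2 * pi * c\<bar> \<le> 2 * pi * e"
  shows "\<bar>c - rotation_number a b \<mu>\<bar> \<le> e"
proof -
  obtain \<rho> where \<rho>: "\<And>x. (\<lambda>n. ((poincare_lift a b \<mu> ^^ n) x - x) / (2 * pi * real n)) \<longlonglongrightarrow> \<rho>"
    by (rule translation_number_exists[of "poincare_lift a b \<mu>" "2 * pi"])
      (auto simp: mono_poincare_lift poincare_lift_shift assms(1))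
  have "rotation_number a b \<mu> = \<rho>"
    unfolding rotation_number_def using \<rho> by (blast intro: the_equality LIMSEQ_unique)
  then show ?thesis using translation_number_bound[OF assms(2) _ \<rho>] by simp
qed

subsection \<open>The oscillatory integral\<close>

text \<open>Integration by parts against the phase: the function \<open>\<mu> x - a t - b sin t\<close> has derivative
  \<open>cos x\<close>, and subtracting \<open>sin x / x'\<close> leaves the derivative \<open>sin x x'' / x'\<^sup>2\<close>. The sign \<open>\<sigma>\<close> is
  the sign of \<open>cos\<close> on the interval.\<close>

lemma nonstationary_bound:
  fixes \<alpha> \<beta> :: real
  assumes "\<mu> > 0" "b > 0" "d > 0" "\<alpha> \<le> \<beta>"
    and \<sigma>: "\<sigma> = 1 \<or> \<sigma> = -1"
    and far: "\<And>t. t \<in> {\<alpha>..\<beta>} \<Longrightarrow> d \<le> \<sigma> * cos t"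
    and a: "\<bar>a\<bar> + 1 \<le> b * d / 2"
    and x: "josephson_solution a b \<mu> {\<alpha>..\<beta>} x"
  shows "\<bar>(\<mu> * x \<beta> - a * \<beta> - b * sin \<beta>) - (\<mu> * x \<alpha> - a * \<alpha> - b * sin \<alpha>)\<bar>
           \<le> 12 * \<mu> / (b * d) + 4 / b * ln (2 / d)"
proof -
  define v where "v t = (cos (x t) + a + b * cos t) / \<mu>" for t
  define v' where "v' t = (- sin (x t) * v t - b * sin t) / \<mu>" for t
  \<comment> \<open>With the sign included \<open>C\<close> is positive, so the same antiderivatives
    serve where the cosine is negative.\<close>
  define S where "S t = \<sigma> * sin t" for t
  define C where "C t = \<sigma> * cos t" for t
  have \<sigma>\<sigma>: "\<sigma> * \<sigma> = 1" and abs\<sigma>: "\<bar>\<sigma>\<bar> = 1" using \<sigma> by auto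
  have dx: "(x has_real_derivative v t) (at t within {\<alpha>..\<beta>})" if "t \<in> {\<alpha>..\<beta>}" for t
    using x that by (simp add: josephson_solution_def v_def)
  have dv: "(v has_real_derivative v' t) (at t within {\<alpha>..\<beta>})" if "t \<in> {\<alpha>..\<beta>}" for t
    unfolding v_def[abs_def] v'_def
    using \<open>\<mu> > 0\<close> by (auto intro!: derivative_eq_intros dx[OF that] simp: v_def)
  have C: "C t \<ge> d" "C t > 0" "C t \<le> 1" if "t \<in> {\<alpha>..\<beta>}" for t
    using far[OF that] \<open>d > 0\<close> \<sigma> cos_le_one[of t] cos_ge_minus_one[of t] by (auto simp: C_def)
  have CS: "(C t)\<^sup>2 + (S t)\<^sup>2 = 1" for t
    using sin_cos_squared_add[of t] \<sigma> by (auto simp: C_def S_def)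
  have S: "1 + S t > 0" "1 - S t > 0" if "t \<in> {\<alpha>..\<beta>}" for t
  proof -
    have "(S t)\<^sup>2 < 1" using CS[of t] C[OF that] by (smt (verit) zero_less_power)
    then have "\<bar>S t\<bar> < 1" by (simp add: abs_square_less_1)
    then show "1 + S t > 0" "1 - S t > 0" by auto
  qed
  \<comment> \<open>The terms \<open>cos (x t) + a\<close> take away at most half of
    \<open>b * C t\<close>.\<close>
  have vbound: "b * C t / (2 * \<mu>) \<le> \<bar>v t\<bar>" if "t \<in> {\<alpha>..\<beta>}" for t
  proof -
    have "b * d \<le> b * C t" using C[OF that] \<open>b > 0\<close> by (intro mult_left_mono) auto
    moreover have "\<bar>b * cos t\<bar> = b * C t"
      using C(2)[OF that] \<open>b > 0\<close> \<sigma> by (auto simp: C_def abs_mult)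
    moreover have "\<bar>b * cos t\<bar> \<le> \<bar>cos (x t) + a + b * cos t\<bar> + \<bar>cos (x t)\<bar> + \<bar>a\<bar>"
      by arith
    ultimately have "b * C t / 2 \<le> \<bar>cos (x t) + a + b * cos t\<bar>"
      using a abs_cos_le_one[of "x t"] by linarith
    then have "b * C t / 2 / \<mu> \<le> \<bar>cos (x t) + a + b * cos t\<bar> / \<mu>"
      using \<open>\<mu> > 0\<close> by (intro divide_right_mono) auto
    then show ?thesis using \<open>\<mu> > 0\<close> by (simp add: v_def)
  qed
  have vpos: "\<bar>v t\<bar> > 0" if "t \<in> {\<alpha>..\<beta>}" for t
  proof -
    have "0 < b * C t / (2 * \<mu>)" using C(2)[OF that] \<open>b > 0\<close> \<open>\<mu> > 0\<close> by simp
    then show ?thesis using vbound[OF that] by linarith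
  qed
  have inv_v: "1 / \<bar>v t\<bar> \<le> 2 * \<mu> / (b * C t)" if "t \<in> {\<alpha>..\<beta>}" for t
    using vbound[OF that] vpos[OF that] C(2)[OF that] \<open>b > 0\<close> \<open>\<mu> > 0\<close>
    by (simp add: field_simps)
  define Q where "Q t = \<mu> * x t - a * t - b * sin t" for t
  \<comment> \<open>An antiderivative of the bound on the integrand: \<open>ln ((1 + S) / C)\<close>
    has derivative \<open>1 / C\<close> and \<open>S / C\<close> has derivative
    \<open>1 / C^2\<close>.\<close>
  define h where "h t = 2 / b * (ln (1 + S t) - ln (C t)) + 4 * \<mu> / b * (S t / C t)" for t
  have main: "\<bar>(Q \<beta> - sin (x \<beta>) / v \<beta>) - (Q \<alpha> - sin (x \<alpha>) / v \<alpha>)\<bar> \<le> h \<beta> - h \<alpha>"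
  proof (rule abs_diff_le_of_derivative_bound[where g = "\<lambda>t. Q t - sin (x t) / v t"
        and g' = "\<lambda>t. sin (x t) * v' t / (v t)\<^sup>2" and h = h
        and h' = "\<lambda>t. 2 / (b * C t) + 4 * \<mu> / (b * (C t)\<^sup>2)"])
    show "\<alpha> \<le> \<beta>" by fact
    fix t assume t: "t \<in> {\<alpha>..\<beta>}"
    have "v t \<noteq> 0" using vpos[OF t] by simp
    have \<mu>v: "\<mu> * v t = cos (x t) + a + b * cos t" using \<open>\<mu> > 0\<close> by (simp add: v_def)
    have "(Q has_real_derivative cos (x t)) (at t within {\<alpha>..\<beta>})"
      unfolding Q_def[abs_def] by (rule derivative_eq_intros dx[OF t] refl)+ (use \<mu>v in \<open>simp add: algebra_simps\<close>)
    moreover have "((\<lambda>t. sin (x t) / v t) has_real_derivative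
        (cos (x t) * v t * v t - sin (x t) * v' t) / (v t * v t)) (at t within {\<alpha>..\<beta>})"
      by (rule derivative_eq_intros dx[OF t] dv[OF t] refl \<open>v t \<noteq> 0\<close>)+
    ultimately have "((\<lambda>t. Q t - sin (x t) / v t) has_real_derivative
        cos (x t) - (cos (x t) * v t * v t - sin (x t) * v' t) / (v t * v t)) (at t within {\<alpha>..\<beta>})"
      by (rule DERIV_diff)
    then show "((\<lambda>t. Q t - sin (x t) / v t) has_real_derivative
        sin (x t) * v' t / (v t)\<^sup>2) (at t within {\<alpha>..\<beta>})"
      using \<open>v t \<noteq> 0\<close> by (simp add: diff_divide_distrib power2_eq_square)
    have dS: "(S has_real_derivative C t) (at t within {\<alpha>..\<beta>})"
      and dC: "(C has_real_derivative - S t) (at t within {\<alpha>..\<beta>})"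
      unfolding S_def[abs_def] C_def[abs_def] by (auto intro!: derivative_eq_intros)
    have "((\<lambda>t. ln (1 + S t) - ln (C t)) has_real_derivative C t / (1 + S t) - (- S t) / C t)
        (at t within {\<alpha>..\<beta>})"
      using S(1)[OF t] C(2)[OF t] by (auto intro!: derivative_eq_intros dS dC)
    moreover have "((\<lambda>t. S t / C t) has_real_derivative
        (C t * C t - S t * (- S t)) / (C t * C t)) (at t within {\<alpha>..\<beta>})"
      using C(2)[OF t] by (intro DERIV_divide dS dC) simp
    ultimately have "(h has_real_derivative 2 / b * (C t / (1 + S t) - (- S t) / C t)
        + 4 * \<mu> / b * ((C t * C t - S t * (- S t)) / (C t * C t))) (at t within {\<alpha>..\<beta>})"
      unfolding h_def[abs_def] by (intro DERIV_add DERIV_cmult)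
    moreover have "C t / (1 + S t) - (- S t) / C t = 1 / C t"
    proof -
      have "C t * C t + S t * (1 + S t) = 1 + S t"
        using CS[of t] by (simp add: power2_eq_square algebra_simps)
      moreover have "1 + S t \<noteq> 0" "C t \<noteq> 0" using S(1)[OF t] C(2)[OF t] by auto
      ultimately show ?thesis by (simp add: add_frac_eq)
    qed
    moreover have "C t * C t - S t * (- S t) = 1" using CS[of t] by (simp add: power2_eq_square)
    ultimately have "(h has_real_derivative 2 / b * (1 / C t) + 4 * \<mu> / b * (1 / (C t * C t)))
        (at t within {\<alpha>..\<beta>})"
      by (simp only:)
    then show "(h has_real_derivative 2 / (b * C t) + 4 * \<mu> / (b * (C t)\<^sup>2)) (at t within {\<alpha>..\<beta>})"
      by (simp add: power2_eq_square)
    have "\<bar>sin (x t) * v' t\<bar> \<le> \<bar>v' t\<bar>"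
      using mult_right_mono[OF abs_sin_le_one[of "x t"], of "\<bar>v' t\<bar>"] by (simp add: abs_mult)
    also have "\<dots> \<le> (\<bar>v t\<bar> + b) / \<mu>"
    proof -
      have "\<bar>sin (x t) * v t\<bar> \<le> \<bar>v t\<bar>"
        using mult_right_mono[OF abs_sin_le_one[of "x t"], of "\<bar>v t\<bar>"] by (simp add: abs_mult)
      moreover have "\<bar>b * sin t\<bar> \<le> b"
        using mult_left_mono[OF abs_sin_le_one[of t], of b] \<open>b > 0\<close> by (simp add: abs_mult)
      ultimately have "\<bar>- sin (x t) * v t - b * sin t\<bar> \<le> \<bar>v t\<bar> + b" by linarith
      then show ?thesis unfolding v'_def using \<open>\<mu> > 0\<close> by (simp add: divide_right_mono)
    qed
    finally have "\<bar>sin (x t) * v' t\<bar> / (v t)\<^sup>2 \<le> (\<bar>v t\<bar> + b) / \<mu> / (v t)\<^sup>2"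
      by (rule divide_right_mono) simp
    then have "\<bar>sin (x t) * v' t / (v t)\<^sup>2\<bar> \<le> (\<bar>v t\<bar> + b) / \<mu> / (v t)\<^sup>2"
      by simp
    also have "\<dots> = 1 / \<mu> * (1 / \<bar>v t\<bar>) + b / \<mu> * (1 / \<bar>v t\<bar>)\<^sup>2"
    proof -
      have "(v t)\<^sup>2 = \<bar>v t\<bar> * \<bar>v t\<bar>" by (simp add: power2_eq_square)
      then show ?thesis using \<open>v t \<noteq> 0\<close> \<open>\<mu> > 0\<close> by (simp add: field_simps power2_eq_square)
    qed
    also have "\<dots> \<le> 1 / \<mu> * (2 * \<mu> / (b * C t)) + b / \<mu> * (2 * \<mu> / (b * C t))\<^sup>2"
      using inv_v[OF t] \<open>\<mu> > 0\<close> \<open>b > 0\<close> by (intro add_mono mult_left_mono power_mono) auto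
    also have "\<dots> = 2 / (b * C t) + 4 * \<mu> / (b * (C t)\<^sup>2)"
      using C(2)[OF t] \<open>\<mu> > 0\<close> \<open>b > 0\<close> by (simp add: field_simps power2_eq_square)
    finally show "\<bar>sin (x t) * v' t / (v t)\<^sup>2\<bar> \<le> 2 / (b * C t) + 4 * \<mu> / (b * (C t)\<^sup>2)" .
  qed
  have boundary: "\<bar>sin (x t) / v t\<bar> \<le> 2 * \<mu> / (b * d)" if t: "t \<in> {\<alpha>..\<beta>}" for t
  proof -
    have "\<bar>sin (x t) / v t\<bar> \<le> 1 / \<bar>v t\<bar>" by (simp add: divide_right_mono)
    also have "\<dots> \<le> 2 * \<mu> / (b * C t)" by (rule inv_v[OF t])
    also have "\<dots> \<le> 2 * \<mu> / (b * d)"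
      using C[OF t] \<open>\<mu> > 0\<close> \<open>b > 0\<close> \<open>d > 0\<close> by (intro divide_left_mono mult_left_mono) auto
    finally show ?thesis .
  qed
  have tan: "\<bar>S t / C t\<bar> \<le> 1 / d" if t: "t \<in> {\<alpha>..\<beta>}" for t
  proof -
    have "\<bar>S t\<bar> \<le> 1" using S[OF t] by linarith
    then have "\<bar>S t\<bar> / C t \<le> 1 / d" using C[OF t] \<open>d > 0\<close> by (intro frac_le) auto
    then show ?thesis using C(2)[OF t] by simp
  qed
  have log: "\<bar>ln (1 + S t) - ln (C t)\<bar> \<le> ln (2 / d)" if t: "t \<in> {\<alpha>..\<beta>}" for t
  proof -
    have "(1 + S t) / C t \<le> 2 / d"
      using C[OF t] S[OF t] \<open>d > 0\<close> by (intro frac_le) auto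
    \<comment> \<open>Bounding the reciprocal as well controls the logarithm from below.\<close>
    moreover have "C t / (1 + S t) \<le> 2 / d"
    proof -
      have "C t / (1 + S t) = (1 - S t) / C t"
        using CS[of t] C(2)[OF t] S(1)[OF t]
        by (simp add: frac_eq_eq power2_eq_square algebra_simps)
      also have "\<dots> \<le> 2 / d" using C[OF t] S[OF t] \<open>d > 0\<close> by (intro frac_le) auto
      finally show ?thesis .
    qed
    ultimately have "ln ((1 + S t) / C t) \<le> ln (2 / d)" "ln (C t / (1 + S t)) \<le> ln (2 / d)"
      using C(2)[OF t] S(1)[OF t] \<open>d > 0\<close> by (auto intro!: ln_mono)
    then show ?thesis using C(2)[OF t] S(1)[OF t] by (auto simp: ln_div abs_le_iff)
  qed
  have ends: "\<alpha> \<in> {\<alpha>..\<beta>}" "\<beta> \<in> {\<alpha>..\<beta>}" using \<open>\<alpha> \<le> \<beta>\<close> by auto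
  have "h \<beta> - h \<alpha> = 2 / b * ((ln (1 + S \<beta>) - ln (C \<beta>)) - (ln (1 + S \<alpha>) - ln (C \<alpha>)))
      + 4 * \<mu> / b * (S \<beta> / C \<beta> - S \<alpha> / C \<alpha>)"
    unfolding h_def by algebra
  also have "\<dots> \<le> 2 / b * (2 * ln (2 / d)) + 4 * \<mu> / b * (2 * (1 / d))"
  proof (intro add_mono mult_left_mono)
    show "(ln (1 + S \<beta>) - ln (C \<beta>)) - (ln (1 + S \<alpha>) - ln (C \<alpha>)) \<le> 2 * ln (2 / d)"
      using log[OF ends(1)] log[OF ends(2)] by linarith
    show "S \<beta> / C \<beta> - S \<alpha> / C \<alpha> \<le> 2 * (1 / d)"
      using tan[OF ends(1)] tan[OF ends(2)] by linarith
  qed (use \<open>b > 0\<close> \<open>\<mu> > 0\<close> in auto)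
  finally have "h \<beta> - h \<alpha> \<le> 4 / b * ln (2 / d) + 8 * \<mu> / (b * d)" by simp
  \<comment> \<open>8 comes from the tangent terms, and 2 from each of the two boundary terms
    \<open>sin x / v\<close>.\<close>
  moreover have "12 * \<mu> / (b * d) = 8 * \<mu> / (b * d) + 2 * (2 * \<mu> / (b * d))"
    by (simp add: add_divide_distrib[symmetric])
  ultimately have "\<bar>Q \<beta> - Q \<alpha>\<bar> \<le> 12 * \<mu> / (b * d) + 4 / b * ln (2 / d)"
    using main boundary[OF ends(1)] boundary[OF ends(2)] by linarith
  then show ?thesis by (simp add: Q_def)
qed

text \<open>The trivial bound \<open>\<bar>cos x\<bar> \<le> 1\<close> on the derivative, meant for
  the short intervals around the zeros of \<open>cos t\<close>.\<close>

lemma phase_diff_le: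
  assumes "\<mu> > 0" "\<alpha> \<le> \<beta>" and x: "josephson_solution a b \<mu> {\<alpha>..\<beta>} x"
  shows "\<bar>(\<mu> * x \<beta> - a * \<beta> - b * sin \<beta>) - (\<mu> * x \<alpha> - a * \<alpha> - b * sin \<alpha>)\<bar> \<le> \<beta> - \<alpha>"
proof (rule abs_diff_le_of_derivative_bound[where g = "\<lambda>t. \<mu> * x t - a * t - b * sin t"
      and g' = "\<lambda>t. cos (x t)" and h = "\<lambda>t. t" and h' = "\<lambda>t. 1"])
  fix t assume "t \<in> {\<alpha>..\<beta>}"
  then have "(x has_real_derivative (cos (x t) + a + b * cos t) / \<mu>) (at t within {\<alpha>..\<beta>})"
    using x by (simp add: josephson_solution_def)
  then show "((\<lambda>t. \<mu> * x t - a * t - b * sin t) has_real_derivative cos (x t)) (at t within {\<alpha>..\<beta>})"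
    using \<open>\<mu> > 0\<close> by (auto intro!: derivative_eq_intros)
qed (use \<open>\<alpha> \<le> \<beta>\<close> in \<open>auto intro!: derivative_eq_intros\<close>)

lemma josephson_solution_subset:
  "josephson_solution a b \<mu> T x \<Longrightarrow> T' \<subseteq> T \<Longrightarrow> josephson_solution a b \<mu> T' x"
  unfolding josephson_solution_def by (meson DERIV_subset subsetD)

text \<open>The derivative \<open>cos t - 1 / 2\<close> is nonnegative up to \<open>pi / 3\<close>,
  which exceeds 1/2.\<close>

lemma half_le_sin:
  fixes x :: real
  assumes "0 \<le> x" "x \<le> 1 / 2"
  shows "x / 2 \<le> sin x"
proof -
  have "(\<lambda>t. sin t - t / 2) 0 \<le> (\<lambda>t. sin t - t / 2) x"
  proof (rule DERIV_nonneg_imp_nondecreasing[OF assms(1)])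
    fix t assume t: "0 \<le> t" "t \<le> x"
    have "cos (pi / 3) \<le> cos t"
      using t assms pi_gt3 by (intro cos_monotone_0_pi_le) auto
    then have "cos t - 1 / 2 \<ge> 0" by (simp add: cos_60)
    moreover have "((\<lambda>t. sin t - t / 2) has_real_derivative cos t - 1 / 2) (at t)"
      by (auto intro!: derivative_eq_intros)
    ultimately show "\<exists>y. ((\<lambda>t. sin t - t / 2) has_real_derivative y) (at t) \<and> 0 \<le> y"
      by blast
  qed
  then show ?thesis by simp
qed

lemma sin_le_cos:
  fixes u :: real
  assumes "0 \<le> \<delta>" "\<bar>u\<bar> \<le> pi / 2 - \<delta>"
  shows "sin \<delta> \<le> cos u"
proof -
  have "cos (pi / 2 - \<delta>) \<le> cos \<bar>u\<bar>"
    using assms pi_gt_zero by (intro cos_monotone_0_pi_le) auto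
  then show ?thesis by (simp add: cos_diff)
qed

text \<open>Three intervals away from the zeros of \<open>cos t\<close> cost \<open>E\<close> each
  and two neighbourhoods cost \<open>2 * \<delta>\<close> each; \<open>3 * 24 + 4 = 76\<close> and
  \<open>3 * 6 = 18\<close>. The choice of \<open>\<delta>\<close> balances the boundary terms, of
  order \<open>\<mu> / (b * \<delta>)\<close>, against the length of the neighbourhoods.\<close>

lemma poincare_lift_displacement:
  assumes "\<mu> > 0" and a: "\<bar>a\<bar> + 1 \<le> 1 / 4 * sqrt (b * \<mu>)" and b: "4 * \<mu> \<le> b"
  shows "\<bar>\<mu> * (poincare_lift a b \<mu> x\<^sub>0 - x\<^sub>0) - 2 * pi * a\<bar>
           \<le> 76 * sqrt (\<mu> / b) + 18 / b * ln (b / \<mu>)"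
proof -
  define \<delta> where "\<delta> = sqrt (\<mu> / b)"
  have "b > 0" using assms by linarith
  have "\<delta> > 0" using \<open>\<mu> > 0\<close> \<open>b > 0\<close> by (simp add: \<delta>_def)
  have \<delta>2: "\<delta> * \<delta> = \<mu> / b" using \<open>\<mu> > 0\<close> \<open>b > 0\<close> by (simp add: \<delta>_def)
  have "\<delta> \<le> sqrt ((1 / 2)\<^sup>2)" unfolding \<delta>_def
    using b \<open>b > 0\<close> by (intro real_sqrt_le_mono) (simp add: field_simps power2_eq_square)
  then have "\<delta> \<le> 1 / 2" by simp
  have half: "\<delta> / 2 \<le> sin \<delta>" using half_le_sin \<open>\<delta> > 0\<close> \<open>\<delta> \<le> 1 / 2\<close> by simp
  define d where "d = sin \<delta>"
  have "d > 0" using half \<open>\<delta> > 0\<close> by (simp add: d_def)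
  \<comment> \<open>Together with \<open>\<delta> / 2 \<le> d\<close>, this turns the factor 1/4 in
    the hypothesis on \<open>a\<close> into the requirement \<open>b * d / 2\<close>.\<close>
  have "sqrt (b * \<mu>) = b * \<delta>"
  proof -
    have "b * \<mu> = (b * \<delta>)\<^sup>2" using \<delta>2 \<open>b > 0\<close> by (simp add: power2_eq_square field_simps)
    then show ?thesis using \<open>b > 0\<close> \<open>\<delta> > 0\<close> by simp
  qed
  moreover have "b * (\<delta> / 2) \<le> b * d" using half \<open>b > 0\<close> unfolding d_def by (intro mult_left_mono) auto
  ultimately have a': "\<bar>a\<bar> + 1 \<le> b * d / 2" using a by simp
  define L where "L = ln (b / \<mu>)"
  define E where "E = 24 * \<delta> + 6 / b * L"
  have E: "12 * \<mu> / (b * d) + 4 / b * ln (2 / d) \<le> E"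
  proof -
    have "12 * \<mu> / (b * d) \<le> 12 * \<mu> / (b * (\<delta> / 2))"
      using half \<open>b > 0\<close> \<open>\<mu> > 0\<close> \<open>\<delta> > 0\<close> \<open>d > 0\<close> unfolding d_def
      by (intro divide_left_mono mult_left_mono) auto
    also have "\<dots> = 24 * (\<mu> / b) / \<delta>" using \<open>b > 0\<close> \<open>\<delta> > 0\<close> by (simp add: field_simps)
    also have "\<dots> = 24 * \<delta>" using \<open>\<delta> > 0\<close> by (simp flip: \<delta>2)
    finally have 1: "12 * \<mu> / (b * d) \<le> 24 * \<delta>" .
    \<comment> \<open>The right-hand side is \<open>ln 4 + L / 2\<close>, and
      \<open>4 \<le> b / \<mu>\<close> absorbs \<open>ln 4\<close> into \<open>L\<close>.\<close>
    have "ln (2 / d) \<le> ln (4 / \<delta>)"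
      using half \<open>\<delta> > 0\<close> \<open>d > 0\<close> unfolding d_def by (intro ln_mono) (auto simp: field_simps)
    also have "\<dots> = ln 4 - ln \<delta>" using \<open>\<delta> > 0\<close> by (simp add: ln_div)
    also have "ln \<delta> = - L / 2"
      using \<open>\<mu> > 0\<close> \<open>b > 0\<close> by (simp add: \<delta>_def L_def ln_sqrt ln_div)
    also have "ln 4 \<le> L"
      unfolding L_def using b \<open>\<mu> > 0\<close> \<open>b > 0\<close> by (intro ln_mono) (auto simp: field_simps)
    finally have "ln (2 / d) \<le> 3 / 2 * L" by simp
    then have "4 / b * ln (2 / d) \<le> 4 / b * (3 / 2 * L)"
      using \<open>b > 0\<close> by (intro mult_left_mono) auto
    then show ?thesis using 1 by (simp add: E_def)
  qed
  obtain x where x: "josephson_solution a b \<mu> {0..2 * pi} x" "x 0 = x\<^sub>0"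
    by (rule josephson_solution_exists[OF \<open>\<mu> > 0\<close>])
  define Q where "Q t = \<mu> * x t - a * t - b * sin t" for t
  have far: "\<bar>Q \<beta> - Q \<alpha>\<bar> \<le> E"
    if "\<alpha> \<le> \<beta>" "0 \<le> \<alpha>" "\<beta> \<le> 2 * pi" "\<sigma> = 1 \<or> \<sigma> = -1"
      and "\<And>t. t \<in> {\<alpha>..\<beta>} \<Longrightarrow> d \<le> \<sigma> * cos t" for \<alpha> \<beta> \<sigma>
  proof -
    have "josephson_solution a b \<mu> {\<alpha>..\<beta>} x"
      using x(1) by (rule josephson_solution_subset) (use that in auto)
    from nonstationary_bound[OF \<open>\<mu> > 0\<close> \<open>b > 0\<close> \<open>d > 0\<close> that(1,4,5) a' this] E
    show ?thesis by (simp add: Q_def)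
  qed
  have near: "\<bar>Q \<beta> - Q \<alpha>\<bar> \<le> \<beta> - \<alpha>" if "\<alpha> \<le> \<beta>" "0 \<le> \<alpha>" "\<beta> \<le> 2 * pi" for \<alpha> \<beta>
  proof -
    have "josephson_solution a b \<mu> {\<alpha>..\<beta>} x"
      using x(1) by (rule josephson_solution_subset) (use that in auto)
    from phase_diff_le[OF \<open>\<mu> > 0\<close> that(1) this] show ?thesis by (simp add: Q_def)
  qed
  note bounds = \<open>\<delta> > 0\<close> \<open>\<delta> \<le> 1 / 2\<close> pi_gt3
  have 1: "\<bar>Q (pi / 2 - \<delta>) - Q 0\<bar> \<le> E"
  proof (rule far[where \<sigma> = 1])
    fix t assume "t \<in> {0..pi / 2 - \<delta>}"
    then show "d \<le> 1 * cos t" using sin_le_cos[of \<delta> t] bounds by (auto simp: d_def)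
  qed (use bounds in auto)
  have 2: "\<bar>Q (3 * pi / 2 - \<delta>) - Q (pi / 2 + \<delta>)\<bar> \<le> E"
  proof (rule far[where \<sigma> = "-1"])
    fix t assume "t \<in> {pi / 2 + \<delta>..3 * pi / 2 - \<delta>}"
    then have "sin \<delta> \<le> cos (t - pi)" using bounds by (intro sin_le_cos) (auto simp: abs_le_iff)
    then show "d \<le> -1 * cos t" by (simp add: d_def)
  qed (use bounds in auto)
  have 3: "\<bar>Q (2 * pi) - Q (3 * pi / 2 + \<delta>)\<bar> \<le> E"
  proof (rule far[where \<sigma> = 1])
    fix t assume "t \<in> {3 * pi / 2 + \<delta>..2 * pi}"
    then have "sin \<delta> \<le> cos (2 * pi - t)" using bounds by (intro sin_le_cos) (auto simp: abs_le_iff)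
    then show "d \<le> 1 * cos t" by (simp add: d_def cos_diff)
  qed (use bounds in auto)
  have 4: "\<bar>Q (pi / 2 + \<delta>) - Q (pi / 2 - \<delta>)\<bar> \<le> 2 * \<delta>"
    using near[of "pi / 2 - \<delta>" "pi / 2 + \<delta>"] bounds by simp
  have 5: "\<bar>Q (3 * pi / 2 + \<delta>) - Q (3 * pi / 2 - \<delta>)\<bar> \<le> 2 * \<delta>"
    using near[of "3 * pi / 2 - \<delta>" "3 * pi / 2 + \<delta>"] bounds by simp
  have "\<bar>Q (2 * pi) - Q 0\<bar> \<le> 3 * E + 4 * \<delta>" using 1 2 3 4 5 by linarith
  also have "\<dots> = 76 * \<delta> + 18 / b * L" by (simp add: E_def)
  finally have "\<bar>Q (2 * pi) - Q 0\<bar> \<le> 76 * \<delta> + 18 / b * L" .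
  \<comment> \<open>The term \<open>b * sin t\<close> vanishes at both ends of the period.\<close>
  moreover have "Q (2 * pi) - Q 0 = \<mu> * (poincare_lift a b \<mu> x\<^sub>0 - x\<^sub>0) - 2 * pi * a"
    using poincare_lift_eq[OF \<open>\<mu> > 0\<close> x(1)] x(2) by (simp add: Q_def algebra_simps)
  ultimately show ?thesis by (simp add: \<delta>_def L_def)
qed

section \<open>Explicit constants and comparison of the two error bounds\<close>

lemma ln_le_two_sqrt:
  fixes x :: real
  assumes "x > 0"
  shows "ln x \<le> 2 * sqrt x"
proof -
  have "ln x = 2 * ln (sqrt x)" using assms by (simp add: ln_sqrt)
  also have "\<dots> \<le> 2 * (sqrt x - 1)" using assms by (intro mult_left_mono ln_le_minus_one) auto
  finally show ?thesis by simp
qed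

theorem theorem1:
  "\<exists>C\<^sub>1 C\<^sub>2 K\<^sub>1 K\<^sub>2 :: real. C\<^sub>1 > 0 \<and> C\<^sub>2 > 0 \<and> K\<^sub>1 > 0 \<and> K\<^sub>2 > 0 \<and>
     (\<forall>a b \<mu> :: real.
        \<mu> > 0 \<and> \<bar>a\<bar> + 1 \<le> C\<^sub>1 * sqrt (b * \<mu>) \<and> b \<ge> C\<^sub>2 * \<mu> \<longrightarrow>
        \<bar>a / \<mu> - rotation_number a b \<mu>\<bar>
          \<le> K\<^sub>1 / sqrt (b * \<mu>) + K\<^sub>2 / (b * \<mu>) * ln (b / \<mu>) \<and>
        K\<^sub>1 / sqrt (b * \<mu>) + K\<^sub>2 / (b * \<mu>) * ln (b / \<mu>)
          \<le> K\<^sub>1 / sqrt (b * \<mu>) + 2 * K\<^sub>2 / sqrt (b * \<mu> ^ 3))"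
\<comment> \<open>All four constants are those of \<open>poincare_lift_displacement\<close>.\<close>
proof (rule exI[of _ "1 / 4"], rule exI[of _ 4], rule exI[of _ 76], rule exI[of _ 18],
    intro conjI allI impI; (elim conjE)?)
  fix a b \<mu> :: real
  assume "\<mu> > 0" and a: "\<bar>a\<bar> + 1 \<le> 1 / 4 * sqrt (b * \<mu>)" and b: "4 * \<mu> \<le> b"
  have "b > 0" using \<open>\<mu> > 0\<close> b by linarith
  define e where "e = 76 / sqrt (b * \<mu>) + 18 / (b * \<mu>) * ln (b / \<mu>)"
  have sq: "sqrt (\<mu> / b) / \<mu> = 1 / sqrt (b * \<mu>)"
    using \<open>\<mu> > 0\<close> \<open>b > 0\<close> by (simp add: real_sqrt_divide real_sqrt_mult field_simps)
  have "b / \<mu> \<ge> 1" using b \<open>\<mu> > 0\<close> by (simp add: field_simps)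
  then have "e \<ge> 0" using \<open>\<mu> > 0\<close> \<open>b > 0\<close> by (simp add: e_def)
  show "\<bar>a / \<mu> - rotation_number a b \<mu>\<bar> \<le> 76 / sqrt (b * \<mu>) + 18 / (b * \<mu>) * ln (b / \<mu>)"
    unfolding e_def[symmetric]
  proof (rule rotation_number_bound[OF \<open>\<mu> > 0\<close>])
    fix x
    let ?P = "poincare_lift a b \<mu> x"
    have "?P - x - 2 * pi * (a / \<mu>) = (\<mu> * (?P - x) - 2 * pi * a) / \<mu>"
      using \<open>\<mu> > 0\<close> by (simp add: field_simps)
    also have "\<bar>\<dots>\<bar> = \<bar>\<mu> * (?P - x) - 2 * pi * a\<bar> / \<mu>" using \<open>\<mu> > 0\<close> by simp
    also have "\<dots> \<le> (76 * sqrt (\<mu> / b) + 18 / b * ln (b / \<mu>)) / \<mu>"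
      using \<open>\<mu> > 0\<close> by (intro divide_right_mono poincare_lift_displacement a b) auto
    also have "\<dots> = 76 * (sqrt (\<mu> / b) / \<mu>) + 18 / (b * \<mu>) * ln (b / \<mu>)"
      by (simp add: add_divide_distrib)
    also have "\<dots> = 1 * e" by (simp add: sq e_def)
    \<comment> \<open>Dividing by the period would improve the constants;
      \<open>1 \<le> 2 * pi\<close> is enough here.\<close>
    also have "\<dots> \<le> 2 * pi * e" using \<open>e \<ge> 0\<close> pi_gt3 by (intro mult_right_mono) auto
    finally show "\<bar>?P - x - 2 * pi * (a / \<mu>)\<bar> \<le> 2 * pi * e" .
  qed
  have "18 / (b * \<mu>) * ln (b / \<mu>) \<le> 18 / (b * \<mu>) * (2 * sqrt (b / \<mu>))"
    using \<open>\<mu> > 0\<close> \<open>b > 0\<close> by (intro mult_left_mono ln_le_two_sqrt) auto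
  also have "\<dots> = 2 * 18 / sqrt (b * \<mu> ^ 3)"
  proof -
    have "b * \<mu> ^ 3 = (b * \<mu>)\<^sup>2 / (b / \<mu>)"
      using \<open>\<mu> > 0\<close> \<open>b > 0\<close> by (simp add: field_simps power2_eq_square power3_eq_cube)
    then have "sqrt (b * \<mu> ^ 3) = b * \<mu> / sqrt (b / \<mu>)"
      using \<open>\<mu> > 0\<close> \<open>b > 0\<close> by (simp only: real_sqrt_divide real_sqrt_power) simp
    then show ?thesis by simp
  qed
  finally show "76 / sqrt (b * \<mu>) + 18 / (b * \<mu>) * ln (b / \<mu>)
      \<le> 76 / sqrt (b * \<mu>) + 2 * 18 / sqrt (b * \<mu> ^ 3)" by simp
qed simp_all

end
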